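(* Let $a(t)=\sum_{n\ge0}a_nt^n$ and $b(t)=\sum_{n\ge0}b_nt^n$ be formal power series in $\mathbb{C}[[t]]$. If $a(t)$ is rational and $b(t)$ is algebraic over $\mathbb{C}(t)$, then the LR-derived generating function $a(t)\ast_{LR}b(t)$ is algebraic over $\mathbb{C}(t)$.
   Context: For $a(t)=\sum_{n\ge0}a_nt^n$ and $b(t)=\sum_{n\ge0}b_nt^n$ in $\mathbb{C}[[t]]$, the Littlewood-Richardson derived (LR-derived) generating function is $a(t)\ast_{LR}b(t)=\sum_{n\ge0}\left(\sum_{k=0}^n\binom{n}{k}a_kb_{n-k}\right)t^n\in\mathbb{C}[[t]]$. Equivalently, it is the ordinary generating function $\sum_n c_nt^n$ of the sequence $\{c_n\}$ determined by $\sum_n c_n\frac{t^n}{n!}=\left(\sum_n a_n\frac{t^n}{n!}\right)\left(\sum_n b_n\frac{t^n}{n!}\right)$. A formal power series in $\mathbb{C}[[t]]$ is rational if it is the power series expansion at $0$ of an element of $\mathbb{C}(t)$, and algebraic if it is algebraic over $\mathbb{C}(t)$ (inside $\mathbb{C}((t))$). *)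

theory Defs
  imports
    "HOL-Computational_Algebra.Computational_Algebra"
    "HOL-Algebra.Algebraic_Closure_Type"
begin

definition lr_derived :: "complex fps \<Rightarrow> complex fps \<Rightarrow> complex fps" (infixl \<open>\<star>\<^sub>L\<^sub>R\<close> 70)
  where "a \<star>\<^sub>L\<^sub>R b =
    Abs_fps (\<lambda>n. \<Sum>k=0..n. of_nat (n choose k) * fps_nth a k * fps_nth b (n - k))"

lemma lr_derived_egf:
  "Abs_fps (\<lambda>n. fps_nth (a \<star>\<^sub>L\<^sub>R b) n / fact n) =
     Abs_fps (\<lambda>n. fps_nth a n / fact n) * Abs_fps (\<lambda>n. fps_nth b n / fact n)"
  by (auto simp: fps_eq_iff lr_derived_def fps_mult_nth sum_divide_distrib binomial_fact
      intro!: sum.cong)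

text \<open>
  The image of \<open>\<complex>(t)\<close> in \<open>\<complex>((t))\<close> under expansion at \<open>0\<close>. The division is that of the field of
  formal Laurent series, so expansions with a pole at \<open>0\<close> are included.
\<close>

definition rational_functions :: "complex fls set"
  where "rational_functions =
    {fps_to_fls (fps_of_poly p) / fps_to_fls (fps_of_poly q) | p q. q \<noteq> 0}"

abbreviation laurent_series_ring :: "complex fls ring"
  where "laurent_series_ring \<equiv> ring_of_type_algebra"

lemma subfield_rational_functions: "subfield rational_functions laurent_series_ring"
proof -
  interpret L: Ring.field laurent_series_ring
    by (rule field_from_type_algebra)
  let ?e = "\<lambda>p :: complex poly. fps_to_fls (fps_of_poly p)"
  have e0: "?e q = 0 \<longleftrightarrow> q = 0" for q
    by simp
  have e_add: "?e (p + q) = ?e p + ?e q" and e_mult: "?e (p * q) = ?e p * ?e q"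
    and e_minus: "?e (- p) = - ?e p" for p q
    by (simp_all add: fps_of_poly_add fps_of_poly_mult fps_of_poly_uminus
        fls_times_fps_to_fls)
  have I: "?e p / ?e q \<in> rational_functions" if "q \<noteq> 0" for p q
    using that unfolding rational_functions_def by blast
  have ops: "carrier laurent_series_ring = UNIV" "\<zero>\<^bsub>laurent_series_ring\<^esub> = 0"
    "\<one>\<^bsub>laurent_series_ring\<^esub> = 1" "x \<oplus>\<^bsub>laurent_series_ring\<^esub> y = x + y"
    "x \<otimes>\<^bsub>laurent_series_ring\<^esub> y = x * y" for x y
    by (simp_all add: ring_of_type_algebra_def)
  have neg: "\<ominus>\<^bsub>laurent_series_ring\<^esub> x = - x" for x
    by (rule L.minus_equality) (simp_all add: ops)
  have inv: "inv\<^bsub>laurent_series_ring\<^esub> x = inverse x" if "x \<noteq> 0" for x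
    by (rule L.comm_inv_char) (use that in \<open>simp_all add: ops\<close>)
  show ?thesis
  proof (rule L.subfieldI'[OF L.subringI])
    show "rational_functions \<subseteq> carrier laurent_series_ring"
      by (simp add: ops)
    show "\<one>\<^bsub>laurent_series_ring\<^esub> \<in> rational_functions"
      using I[of 1 1] by (simp add: ops)
  next
    fix x assume "x \<in> rational_functions"
    then obtain p q where x: "x = ?e p / ?e q" "q \<noteq> 0"
      unfolding rational_functions_def by blast
    show "\<ominus>\<^bsub>laurent_series_ring\<^esub> x \<in> rational_functions"
      using I[of q "- p"] x by (simp add: neg e_minus)
  next
    fix x y assume "x \<in> rational_functions" "y \<in> rational_functions"
    then obtain p q r s where xy: "x = ?e p / ?e q" "q \<noteq> 0" "y = ?e r / ?e s" "s \<noteq> 0"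
      unfolding rational_functions_def by blast
    have "x * y = ?e (p * r) / ?e (q * s)"
      by (simp add: xy e_mult)
    then show "x \<otimes>\<^bsub>laurent_series_ring\<^esub> y \<in> rational_functions"
      using I[of "q * s" "p * r"] xy by (simp add: ops)
    have "?e q \<noteq> 0" "?e s \<noteq> 0"
      using xy e0 by blast+
    then have "x + y = ?e (p * s + r * q) / ?e (q * s)"
      unfolding e_add e_mult xy by (rule add_frac_eq)
    then show "x \<oplus>\<^bsub>laurent_series_ring\<^esub> y \<in> rational_functions"
      using I[of "q * s" "p * s + r * q"] xy by (simp add: ops)
  next
    fix x assume "x \<in> rational_functions - {\<zero>\<^bsub>laurent_series_ring\<^esub>}"
    then obtain p q where x: "x = ?e p / ?e q" "q \<noteq> 0" "x \<noteq> 0"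
      unfolding rational_functions_def by (auto simp: ops)
    then have "p \<noteq> 0" "inverse x = ?e q / ?e p"
      by auto
    then show "inv\<^bsub>laurent_series_ring\<^esub> x \<in> rational_functions"
      using I[of p q] x by (simp add: inv)
  qed
qed

definition rational_fps :: "complex fps \<Rightarrow> bool"
  where "rational_fps f \<longleftrightarrow> fps_to_fls f \<in> rational_functions"

definition algebraic_fps :: "complex fps \<Rightarrow> bool"
  where "algebraic_fps f \<longleftrightarrow>
    (ring.algebraic laurent_series_ring over rational_functions) (fps_to_fls f)"

end

theory Submission
  imports Defs
begin

text \<open>
  Call \<open>a\<close> a multiplier if \<open>a \<star>\<^sub>L\<^sub>R b\<close> is algebraic for every algebraic \<open>b\<close>. Multipliers form a linear
  space that is closed under \<open>\<star>\<^sub>L\<^sub>R\<close>, because \<open>\<star>\<^sub>L\<^sub>R\<close> is associative, and under \<open>\<theta> = t d/dt\<close>, because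
  \<open>\<theta>\<close> preserves algebraicity and is a derivation of \<open>\<star>\<^sub>L\<^sub>R\<close> (it commutes with the passage to exponential
  generating functions). Now \<open>t \<star>\<^sub>L\<^sub>R b = \<theta>(t b)\<close>, so all powers of \<open>t\<close> are multipliers; and
  \<open>1/(1-ct) \<star>\<^sub>L\<^sub>R b\<close> is \<open>1/(1-ct)\<close> times \<open>b(t/(1-ct))\<close>, so \<open>1/(1-ct)\<close> is a multiplier, and \<open>\<theta>\<close> raises the
  order of its pole. By partial fractions every rational power series is a multiplier.
\<close>

subsection \<open>Algebraic Laurent and power series\<close>

lemma laurent_series_ring_simps:
  "carrier laurent_series_ring = UNIV"
  "\<zero>\<^bsub>laurent_series_ring\<^esub> = 0"
  "\<one>\<^bsub>laurent_series_ring\<^esub> = 1"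
  "x \<oplus>\<^bsub>laurent_series_ring\<^esub> y = x + y"
  "x \<otimes>\<^bsub>laurent_series_ring\<^esub> y = x * y"
  by (simp_all add: ring_of_type_algebra_def)

lemma laurent_series_ring_pow: "x [^]\<^bsub>laurent_series_ring\<^esub> (n :: nat) = x ^ n"
proof -
  interpret L: Ring.field laurent_series_ring
    by (rule field_from_type_algebra)
  show ?thesis
    by (induction n) (simp_all add: laurent_series_ring_simps mult.commute)
qed

lemma laurent_series_ring_inv: "x \<noteq> 0 \<Longrightarrow> inv\<^bsub>laurent_series_ring\<^esub> x = inverse x"
proof -
  interpret L: Ring.field laurent_series_ring
    by (rule field_from_type_algebra)
  show "x \<noteq> 0 \<Longrightarrow> inv\<^bsub>laurent_series_ring\<^esub> x = inverse x"
    by (rule L.comm_inv_char) (simp_all add: laurent_series_ring_simps)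
qed

text \<open>List polynomials of the abstract ring put the leading coefficient first, while
  \<open>Poly\<close> expects the constant term first; hence the \<open>rev\<close>.\<close>

lemma laurent_series_ring_eval:
  "ring.eval laurent_series_ring p x = poly (Poly (rev p)) x"
proof -
  interpret L: Ring.field laurent_series_ring
    by (rule field_from_type_algebra)
  show ?thesis
    by (induction p)
      (simp_all add: laurent_series_ring_simps laurent_series_ring_pow Poly_append poly_monom
        mult.commute add.commute)
qed

lemma subfield_laurent_series_ring_closed:
  assumes "subfield K laurent_series_ring"
  shows "0 \<in> K" "1 \<in> K"
    "x \<in> K \<Longrightarrow> y \<in> K \<Longrightarrow> x + y \<in> K"
    "x \<in> K \<Longrightarrow> y \<in> K \<Longrightarrow> x * y \<in> K"
    "x \<in> K \<Longrightarrow> inverse x \<in> K"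
proof -
  interpret L: Ring.field laurent_series_ring
    by (rule field_from_type_algebra)
  note S = subfieldE[OF assms] subringE[OF subfieldE(1)[OF assms]]
  show z: "0 \<in> K" and "1 \<in> K"
    using S laurent_series_ring_simps by metis+
  show "x \<in> K \<Longrightarrow> y \<in> K \<Longrightarrow> x + y \<in> K"
    using S laurent_series_ring_simps by metis
  show "x \<in> K \<Longrightarrow> y \<in> K \<Longrightarrow> x * y \<in> K"
    using S laurent_series_ring_simps by metis
  show "inverse x \<in> K" if x: "x \<in> K"
  \<comment> \<open>The abstract inverse is only known to agree with \<open>inverse\<close> off
    zero; at zero the convention \<open>inverse 0 = 0\<close> settles the claim.\<close>
  proof (cases "x = 0")
    case False
    then have "inv\<^bsub>laurent_series_ring\<^esub> x \<in> K"
      using L.subfield_m_inv(1)[OF assms] x by (simp add: laurent_series_ring_simps)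
    with False show ?thesis
      by (simp add: laurent_series_ring_inv)
  qed (use z in simp)
qed

text \<open>Taken as a set so that the subfield closure lemma serves both this field and
  \<open>rational_functions\<close>.\<close>

definition algebraic_functions :: "complex fls set"
  where "algebraic_functions =
    {x. (ring.algebraic laurent_series_ring over rational_functions) x}"

lemma algebraic_fps_iff: "algebraic_fps f \<longleftrightarrow> fps_to_fls f \<in> algebraic_functions"
  by (simp add: algebraic_fps_def algebraic_functions_def)

lemma subfield_algebraic_functions: "subfield algebraic_functions laurent_series_ring"
proof -
  interpret L: Ring.field laurent_series_ring
    by (rule field_from_type_algebra)
  show ?thesis
    using L.subfield_of_algebraics[OF subfield_rational_functions]
    by (simp add: algebraic_functions_def laurent_series_ring_simps)
qed

lemmas rational_functions_closed =
  subfield_laurent_series_ring_closed[OF subfield_rational_functions]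

lemmas algebraic_functions_closed =
  subfield_laurent_series_ring_closed[OF subfield_algebraic_functions]

lemma rational_imp_algebraic_functions:
  assumes "x \<in> rational_functions"
  shows "x \<in> algebraic_functions"
proof -
  interpret L: Ring.field laurent_series_ring
    by (rule field_from_type_algebra)
  show ?thesis
    using L.algebraic_self[OF subfieldE(1)[OF subfield_rational_functions] assms]
    by (simp add: algebraic_functions_def)
qed

section \<open>Arithmetic of rational and algebraic power series\<close>

lemma rational_fps_of_poly: "rational_fps (fps_of_poly p)"
proof -
  have "fps_to_fls (fps_of_poly p) / fps_to_fls (fps_of_poly 1) \<in> rational_functions"
    unfolding rational_functions_def using one_neq_zero by blast
  then show ?thesis
    by (simp add: rational_fps_def)
qed

lemma rational_fps_closed:
  shows rational_fps_add: "rational_fps f \<Longrightarrow> rational_fps g \<Longrightarrow> rational_fps (f + g)"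
    and rational_fps_mult: "rational_fps f \<Longrightarrow> rational_fps g \<Longrightarrow> rational_fps (f * g)"
    and rational_fps_const: "rational_fps (fps_const c)"
    and rational_fps_X: "rational_fps fps_X"
  using rational_functions_closed(3,4) rational_fps_of_poly[of "[:c:]"]
    rational_fps_of_poly[of "[:0, 1:]"]
  by (simp_all add: rational_fps_def fps_of_poly_pCons fls_times_fps_to_fls)

lemma rational_fps_inverse:
  assumes "rational_fps f" "fps_nth f 0 \<noteq> 0"
  shows "rational_fps (inverse f)"
proof -
  have "fps_to_fls (inverse f) = inverse (fps_to_fls f)"
    using assms(2) by (simp add: fls_inverse_fps_to_fls)
  then show ?thesis
    using assms(1) rational_functions_closed(5) by (simp add: rational_fps_def)
qed

lemma algebraic_fps_add: "algebraic_fps f \<Longrightarrow> algebraic_fps g \<Longrightarrow> algebraic_fps (f + g)"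
  using algebraic_functions_closed(3) by (simp add: algebraic_fps_iff)

lemma algebraic_fps_mult: "algebraic_fps f \<Longrightarrow> algebraic_fps g \<Longrightarrow> algebraic_fps (f * g)"
  using algebraic_functions_closed(4) by (simp add: algebraic_fps_iff fls_times_fps_to_fls)

lemma rational_imp_algebraic_fps: "rational_fps f \<Longrightarrow> algebraic_fps f"
  using rational_imp_algebraic_functions by (simp add: algebraic_fps_iff rational_fps_def)

text \<open>The division takes place among Laurent series, so \<open>f\<close> may vanish at
  0.\<close>

lemma algebraic_fps_cancel:
  assumes "algebraic_fps (f * g)" "algebraic_fps f" "f \<noteq> 0"
  shows "algebraic_fps g"
proof -
  have "fps_to_fls g = fps_to_fls (f * g) * inverse (fps_to_fls f)"
    using assms(3) by (simp add: fls_times_fps_to_fls)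
  then show ?thesis
    using assms(1,2) algebraic_functions_closed(4,5) by (simp add: algebraic_fps_iff)
qed

lemma algebraic_fps_minus: "algebraic_fps f \<Longrightarrow> algebraic_fps (- f)"
  using algebraic_fps_mult[OF rational_imp_algebraic_fps[OF rational_fps_const[of "-1"]], of f]
  by (simp flip: fps_const_neg)

text \<open>Coefficients may be rational series, not just polynomials, because substituting a
  rational series into an equation produces such coefficients.\<close>

lemma algebraic_fpsI:
  assumes "P \<noteq> 0" "\<And>i. rational_fps (poly.coeff P i)" "poly P f = 0"
  shows "algebraic_fps f"
proof -
  interpret L: Ring.field laurent_series_ring
    by (rule field_from_type_algebra)
  define Q where "Q = map_poly fps_to_fls P"
  define p where "p = rev (coeffs Q)"
  have Q0: "Q \<noteq> 0"
    using assms(1) by (simp add: Q_def map_poly_eq_0_iff)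
  have cQ: "poly.coeff Q i \<in> rational_functions" for i
    using assms(2) by (simp add: Q_def coeff_map_poly rational_fps_def)
  have "poly Q (fps_to_fls f) = fps_to_fls (poly P f)" for f
    unfolding Q_def by (induction P) (simp_all add: map_poly_pCons fls_times_fps_to_fls)
  then have Qf: "poly Q (fps_to_fls f) = 0"
    using assms(3) by simp
  \<comment> \<open>\<open>coeffs\<close> ends in the nonzero leading coefficient, so the reversed
    list has the nonzero head that a list polynomial must have.\<close>
  have "polynomial\<^bsub>laurent_series_ring\<^esub> rational_functions p"
    unfolding polynomial_def using Q0 cQ
    by (auto simp: p_def laurent_series_ring_simps hd_rev last_coeffs_eq_coeff_degree coeffs_def)
  then have "p \<in> carrier (rational_functions [X]\<^bsub>laurent_series_ring\<^esub>)"
    by (simp add: univ_poly_carrier)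
  moreover have "p \<noteq> []"
    using Q0 by (simp add: p_def)
  moreover have "L.eval p (fps_to_fls f) = \<zero>\<^bsub>laurent_series_ring\<^esub>"
    using Qf by (simp add: laurent_series_ring_eval p_def laurent_series_ring_simps)
  ultimately show ?thesis
    unfolding algebraic_fps_def by (rule L.algebraicI)
qed

text \<open>The common denominator is the product of the coefficient denominators: a new coefficient
  \<open>r / s\<close> becomes \<open>d * r\<close>, and the numerators found so far are scaled by
  \<open>s\<close>.\<close>

lemma clear_denominators:
  assumes "\<And>i. poly.coeff Q i \<in> rational_functions"
  shows "\<exists>d P. d \<noteq> 0 \<and>
    smult (fps_to_fls (fps_of_poly d)) Q = map_poly (\<lambda>p. fps_to_fls (fps_of_poly p)) P"
  using assms
proof (induction Q)
  case 0
  show ?case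
    by (rule exI[of _ 1], rule exI[of _ 0]) simp
next
  case (pCons a Q)
  have "poly.coeff Q i \<in> rational_functions" for i
    using pCons.prems[of "Suc i"] by simp
  then obtain d P where dP: "d \<noteq> 0"
    "smult (fps_to_fls (fps_of_poly d)) Q = map_poly (\<lambda>p. fps_to_fls (fps_of_poly p)) P"
    using pCons.IH by blast
  obtain r s where rs: "a = fps_to_fls (fps_of_poly r) / fps_to_fls (fps_of_poly s)" "s \<noteq> 0"
    using pCons.prems[of 0] by (auto simp: rational_functions_def)
  have "smult (fps_to_fls (fps_of_poly (s * d))) Q =
      map_poly (\<lambda>p. fps_to_fls (fps_of_poly p)) (smult s P)"
    unfolding fps_of_poly_mult fls_times_fps_to_fls smult_smult[symmetric] dP(2)
    by (simp add: poly_eq_iff coeff_map_poly fps_of_poly_mult fls_times_fps_to_fls)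
  then have "smult (fps_to_fls (fps_of_poly (s * d))) (pCons a Q) =
      map_poly (\<lambda>p. fps_to_fls (fps_of_poly p)) (pCons (d * r) (smult s P))"
    using rs by (simp add: map_poly_pCons fps_of_poly_mult fls_times_fps_to_fls)
  moreover have "s * d \<noteq> 0"
    using dP rs by simp
  ultimately show ?case
    by blast
qed

text \<open>With denominators cleared, the equation has coefficients in \<complex>[t], which can be
  differentiated and composed with a power series.\<close>

lemma algebraic_fpsE:
  assumes "algebraic_fps f"
  obtains P where "P \<noteq> 0" "poly (map_poly fps_of_poly P) f = 0"
proof -
  interpret L: Ring.field laurent_series_ring
    by (rule field_from_type_algebra)
  let ?K = rational_functions
  have alg: "(L.algebraic over ?K) (fps_to_fls f)"
    using assms by (simp add: algebraic_fps_def)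
  obtain p where p: "p \<in> carrier (?K [X]\<^bsub>laurent_series_ring\<^esub>)" "p \<noteq> []"
    "L.eval p (fps_to_fls f) = \<zero>\<^bsub>laurent_series_ring\<^esub>"
    using L.algebraicE[OF subfieldE(1)[OF subfield_rational_functions] _ alg]
    by (auto simp: laurent_series_ring_simps)
  have pK: "set p \<subseteq> ?K" "hd p \<noteq> 0"
    using p(1,2) by (auto simp: univ_poly_carrier[symmetric] polynomial_def
        laurent_series_ring_simps)
  define Q where "Q = Poly (rev p)"
  \<comment> \<open>After the reversal, the head of \<open>p\<close> is the top coefficient of
    \<open>Q\<close>; this keeps \<open>Q\<close> nonzero.\<close>
  have "poly.coeff Q (length p - 1) = hd p"
    using p(2) by (simp add: Q_def nth_default_def rev_nth hd_conv_nth)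
  then have Q0: "Q \<noteq> 0"
    using pK(2) by auto
  have "poly.coeff Q i \<in> ?K" for i
    using pK(1) rational_functions_closed(1) nth_mem[of i "rev p"]
    by (auto simp: Q_def nth_default_def simp del: nth_mem)
  then obtain d P where dP: "d \<noteq> 0"
    "smult (fps_to_fls (fps_of_poly d)) Q = map_poly (\<lambda>p. fps_to_fls (fps_of_poly p)) P"
    using clear_denominators by blast
  have eval: "poly (map_poly (\<lambda>p. fps_to_fls (fps_of_poly p)) P) (fps_to_fls f) =
      fps_to_fls (poly (map_poly fps_of_poly P) f)" for P
    by (induction P) (simp_all add: map_poly_pCons fls_times_fps_to_fls)
  have "poly Q (fps_to_fls f) = 0"
    using p(3) by (simp add: Q_def laurent_series_ring_eval laurent_series_ring_simps)
  then have "poly (smult (fps_to_fls (fps_of_poly d)) Q) (fps_to_fls f) = 0"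
    by simp
  then have "poly (map_poly fps_of_poly P) f = 0"
    unfolding dP(2) eval by simp
  moreover have "P \<noteq> 0"
    using dP Q0 by auto
  ultimately show thesis
    using that by blast
qed

section \<open>Differentiation and substitution\<close>

lemma algebraic_fps_poly:
  assumes "algebraic_fps f"
  shows "algebraic_fps (poly (map_poly fps_of_poly P) f)"
proof (induction P)
  case 0
  show ?case
    using rational_imp_algebraic_fps[OF rational_fps_const[of 0]] by simp
next
  case (pCons a P)
  then show ?case
    by (simp add: map_poly_pCons algebraic_fps_add algebraic_fps_mult assms
        rational_imp_algebraic_fps rational_fps_of_poly)
qed

text \<open>The chain rule for P(t, f(t)): \<open>map_poly pderiv P\<close> is the partial
  derivative in t, \<open>pderiv P\<close> the one in the second variable.\<close>

lemma fps_deriv_poly: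
  "fps_deriv (poly (map_poly fps_of_poly P) f) =
    poly (map_poly fps_of_poly (map_poly pderiv P)) f +
    poly (map_poly fps_of_poly (pderiv P)) f * fps_deriv f"
proof (induction P)
  case (pCons a P)
  have "map_poly fps_of_poly (p + q) = map_poly fps_of_poly p + map_poly fps_of_poly q"
    for p q :: "'a poly poly"
    by (simp add: poly_eq_iff coeff_map_poly fps_of_poly_add)
  with pCons show ?case
    by (simp add: map_poly_pCons pderiv_pCons fps_of_poly_pderiv algebra_simps)
qed simp

text \<open>
  Differentiating a relation \<open>P(t, f) = 0\<close> of least degree in \<open>f\<close> expresses \<open>f'\<close> rationally in \<open>f\<close>.
\<close>

lemma algebraic_fps_deriv:
  assumes "algebraic_fps f"
  shows "algebraic_fps (fps_deriv f)"
proof -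
  define R where "R = (\<lambda>P. P \<noteq> 0 \<and> poly (map_poly fps_of_poly P) f = 0)"
  have "\<exists>P. R P"
    using algebraic_fpsE[OF assms] by (auto simp: R_def)
  then obtain P where P: "R P" and min: "\<And>Q. R Q \<Longrightarrow> Polynomial.degree P \<le> Polynomial.degree Q"
    using ex_has_least_nat[of R _ Polynomial.degree] by blast
  have "Polynomial.degree P \<noteq> 0"
  proof
    assume "Polynomial.degree P = 0"
    then obtain c where "P = [:c:]"
      using degree_eq_zeroE by blast
    with P show False
      by (simp add: R_def map_poly_pCons)
  qed
  then have "pderiv P \<noteq> 0" "Polynomial.degree (pderiv P) < Polynomial.degree P"
    by (simp_all add: pderiv_eq_0_iff degree_pderiv)
  \<comment> \<open>\<open>pderiv P\<close> is nonzero of smaller degree, so minimality forbids it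
    to vanish at \<open>f\<close>; this permits the division below.\<close>
  with min have nz: "poly (map_poly fps_of_poly (pderiv P)) f \<noteq> 0"
    unfolding R_def using leD by blast
  have "poly (map_poly fps_of_poly (map_poly pderiv P)) f +
      poly (map_poly fps_of_poly (pderiv P)) f * fps_deriv f = 0"
    using P fps_deriv_poly[of P f] by (simp add: R_def)
  then have "poly (map_poly fps_of_poly (pderiv P)) f * fps_deriv f =
      - poly (map_poly fps_of_poly (map_poly pderiv P)) f"
    by (simp add: eq_neg_iff_add_eq_0 add.commute)
  then show ?thesis
    using algebraic_fps_cancel[OF _ algebraic_fps_poly[OF assms] nz]
      algebraic_fps_minus[OF algebraic_fps_poly[OF assms]] by metis
qed

lemma algebraic_fps_XD: "algebraic_fps f \<Longrightarrow> algebraic_fps (fps_XD f)"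
  by (simp add: fps_XD_def algebraic_fps_mult algebraic_fps_deriv rational_fps_X
      rational_imp_algebraic_fps)

text \<open>Substituting \<open>g\<close> into an equation P(t, f) = 0 turns each coefficient into a
  rational series. The new equation is nontrivial because composition with a nonzero series without
  constant term is injective.\<close>

lemma algebraic_fps_compose:
  assumes f: "algebraic_fps f" and g: "rational_fps g" "g \<noteq> 0" "fps_nth g 0 = 0"
  shows "algebraic_fps (f oo g)"
proof -
  obtain P where P: "P \<noteq> 0" "poly (map_poly fps_of_poly P) f = 0"
    using algebraic_fpsE[OF f] .
  have rat: "rational_fps (fps_of_poly p oo g)" for p
    by (induction p)
      (simp_all add: fps_of_poly_pCons fps_compose_add_distrib fps_compose_mult_distrib g
        rational_fps_closed rational_fps_const[of 0, simplified])
  show ?thesis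
  proof (rule algebraic_fpsI)
    show "map_poly (\<lambda>p. fps_of_poly p oo g) P \<noteq> 0"
      using P(1) g by (subst map_poly_eq_0_iff) (auto simp: fps_compose_eq_0_iff)
    show "rational_fps (poly.coeff (map_poly (\<lambda>p. fps_of_poly p oo g) P) i)" for i
      using rat by (simp add: coeff_map_poly)
    have "poly (map_poly (\<lambda>p. fps_of_poly p oo g) P) (f oo g) =
        poly (map_poly fps_of_poly P) f oo g"
      by (induction P)
        (simp_all add: map_poly_pCons fps_compose_add_distrib fps_compose_mult_distrib g)
    then show "poly (map_poly (\<lambda>p. fps_of_poly p oo g) P) (f oo g) = 0"
      using P(2) by simp
  qed
qed

subsection \<open>Binomial convolution\<close>

definition geometric_fps :: "complex \<Rightarrow> complex fps"
  where "geometric_fps c = inverse (1 - fps_const c * fps_X)"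

lemma geometric_fps_mult: "(1 - fps_const c * fps_X) * geometric_fps c = 1"
  unfolding geometric_fps_def by (rule inverse_mult_eq_1') simp

lemma rational_geometric_fps: "rational_fps (geometric_fps c)"
  unfolding geometric_fps_def
  using rational_fps_of_poly[of "[:1, - c:]"]
  by (intro rational_fps_inverse) (simp_all add: fps_of_poly_pCons mult.commute flip: fps_const_neg)

text \<open>The binomial series of (1 - ct) to the power -(n+1).\<close>

lemma geometric_fps_power_nth:
  "fps_nth (geometric_fps c ^ Suc n) k = of_nat ((n + k) choose k) * c ^ k"
  using one_minus_const_fps_X_neg_power'[of "Suc n" c]
  unfolding geometric_fps_def fps_inverse_power[symmetric] by simp

lemma lr_derived_nth:
  "fps_nth (a \<star>\<^sub>L\<^sub>R b) n = (\<Sum>k=0..n. of_nat (n choose k) * fps_nth a k * fps_nth b (n - k))"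
  by (simp add: lr_derived_def)

lemma lr_derived_add_left: "(a + a') \<star>\<^sub>L\<^sub>R b = a \<star>\<^sub>L\<^sub>R b + a' \<star>\<^sub>L\<^sub>R b"
  by (simp add: fps_eq_iff lr_derived_nth algebra_simps sum.distrib)

lemma lr_derived_const_left: "(fps_const c * a) \<star>\<^sub>L\<^sub>R b = fps_const c * (a \<star>\<^sub>L\<^sub>R b)"
  by (simp add: fps_eq_iff lr_derived_nth sum_distrib_left algebra_simps)

text \<open>Both sides have the same exponential generating function, a product of three series, and
  dividing coefficients by factorials is injective.\<close>

lemma lr_derived_assoc: "(a \<star>\<^sub>L\<^sub>R b) \<star>\<^sub>L\<^sub>R c = a \<star>\<^sub>L\<^sub>R (b \<star>\<^sub>L\<^sub>R c)"
proof -
  have "Abs_fps (\<lambda>n. fps_nth ((a \<star>\<^sub>L\<^sub>R b) \<star>\<^sub>L\<^sub>R c) n / fact n) =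
      Abs_fps (\<lambda>n. fps_nth (a \<star>\<^sub>L\<^sub>R (b \<star>\<^sub>L\<^sub>R c)) n / fact n)"
    unfolding lr_derived_egf by (rule mult.assoc)
  then show ?thesis
    by (simp add: fps_eq_iff)
qed

lemma lr_derived_1_left: "1 \<star>\<^sub>L\<^sub>R b = b"
  by (auto simp: fps_eq_iff lr_derived_nth if_distrib if_distribR sum.delta cong: if_cong)

text \<open>Only the summand k = 1 survives, giving n times the coefficient of \<open>b\<close> at n
  - 1.\<close>

lemma lr_derived_X_left: "fps_X \<star>\<^sub>L\<^sub>R b = fps_XD (fps_X * b)"
  by (auto simp: fps_eq_iff lr_derived_nth fps_X_nth if_distrib if_distribR sum.delta
      cong: if_cong)

text \<open>Termwise, the factor n splits as k + (n - k).\<close>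

lemma fps_XD_lr_derived:
  "fps_XD (a \<star>\<^sub>L\<^sub>R b) = fps_XD a \<star>\<^sub>L\<^sub>R b + a \<star>\<^sub>L\<^sub>R fps_XD b"
  by (auto simp: fps_eq_iff lr_derived_nth sum_distrib_left algebra_simps of_nat_diff
      simp flip: sum.distrib intro!: sum.cong)

lemma fps_compose_mult_nth:
  fixes b g h :: "'a :: comm_ring_1 fps"
  assumes "fps_nth g 0 = 0"
  shows "fps_nth ((b oo g) * h) n = (\<Sum>i=0..n. fps_nth b i * fps_nth (g ^ i * h) n)"
proof -
  \<comment> \<open>\<open>g ^ i\<close> has no terms below degree i, so the bound j can be raised
    to a common n, after which the two sums can be exchanged.\<close>
  have "fps_nth (b oo g) j = (\<Sum>i=0..n. fps_nth b i * fps_nth (g ^ i) j)" if "j \<le> n" for j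
    unfolding fps_compose_nth using that assms
    by (intro sum.mono_neutral_left) (auto simp: startsby_zero_power_prefix)
  then have "fps_nth ((b oo g) * h) n =
      (\<Sum>j=0..n. \<Sum>i=0..n. fps_nth b i * fps_nth (g ^ i) j * fps_nth h (n - j))"
    unfolding fps_mult_nth by (intro sum.cong) (simp_all add: sum_distrib_right)
  also have "\<dots> = (\<Sum>i=0..n. fps_nth b i * fps_nth (g ^ i * h) n)"
    by (subst sum.swap) (simp add: fps_mult_nth sum_distrib_left mult.assoc)
  finally show ?thesis .
qed

text \<open>The right side is the sum of b_i t^i / (1 - ct)^(i+1), and t^i / (1 - ct)^(i+1) has
  coefficient (n choose i) c^(n-i) at t^n.\<close>

lemma geometric_lr_derived:
  "geometric_fps c \<star>\<^sub>L\<^sub>R b = (b oo (fps_X * geometric_fps c)) * geometric_fps c"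
proof (rule fps_ext)
  fix n
  have coeff: "fps_nth ((fps_X * geometric_fps c) ^ i * geometric_fps c) n =
      of_nat (n choose i) * c ^ (n - i)" if "i \<le> n" for i
  proof -
    have "(fps_X * geometric_fps c) ^ i * geometric_fps c = fps_X ^ i * geometric_fps c ^ Suc i"
      by (simp add: power_mult_distrib mult_ac)
    then show ?thesis
      using that geometric_fps_power_nth[of c i "n - i"]
      by (simp add: fps_X_power_mult_nth binomial_symmetric[of i n] del: power_Suc)
  qed
  have "fps_nth (geometric_fps c \<star>\<^sub>L\<^sub>R b) n =
      (\<Sum>k=0..n. of_nat (n choose k) * c ^ k * fps_nth b (n - k))"
    using geometric_fps_power_nth[of c 0] by (simp add: lr_derived_nth)
  also have "\<dots> = (\<Sum>i=0..n. fps_nth b i * (of_nat (n choose i) * c ^ (n - i)))"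
    by (rule sum.reindex_bij_witness[of _ "\<lambda>i. n - i" "\<lambda>i. n - i"])
      (auto simp: binomial_symmetric[symmetric])
  also have "\<dots> = fps_nth ((b oo (fps_X * geometric_fps c)) * geometric_fps c) n"
    by (subst fps_compose_mult_nth) (simp_all add: coeff)
  finally show "fps_nth (geometric_fps c \<star>\<^sub>L\<^sub>R b) n =
      fps_nth ((b oo (fps_X * geometric_fps c)) * geometric_fps c) n" .
qed

text \<open>With m = n + 1, \<theta> sends (1 - ct)^(-m) to m ct (1 - ct)^(-m-1), and ct = 1 - (1 -
  ct). On coefficients this is an absorption identity for binomials.\<close>

lemma fps_XD_geometric_power:
  "fps_XD (geometric_fps c ^ Suc n) =
    fps_const (of_nat (Suc n)) * (geometric_fps c ^ Suc (Suc n) - geometric_fps c ^ Suc n)"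
proof (rule fps_ext)
  fix k
  have "Suc n * (Suc n + k choose k) = (Suc n + k) * (n + k choose k)"
    using Suc_times_binomial_add[of n k] binomial_symmetric[of k "n + k"]
      binomial_symmetric[of k "Suc n + k"] Suc_times_binomial_eq[of "n + k" n]
    by (simp add: mult_ac)
  then have *: "of_nat (Suc n) * of_nat (Suc n + k choose k) =
      (of_nat (Suc n) + of_nat k) * (of_nat (n + k choose k) :: complex)"
    by (metis of_nat_add of_nat_mult)
  show "fps_nth (fps_XD (geometric_fps c ^ Suc n)) k =
      fps_nth (fps_const (of_nat (Suc n)) *
        (geometric_fps c ^ Suc (Suc n) - geometric_fps c ^ Suc n)) k"
    unfolding fps_XD_nth fps_mult_left_const_nth fps_sub_nth geometric_fps_power_nth
      right_diff_distrib mult.assoc[symmetric] *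
    by (simp add: algebra_simps)
qed

subsection \<open>Partial fractions\<close>

text \<open>The poles lie at 1/c, hence never at 0. As an inductive predicate, this span allows rule
  induction for properties stable under linear combinations.\<close>

inductive partial_fractions :: "complex fps \<Rightarrow> bool"
  where
    monomial: "partial_fractions (fps_X ^ k)"
  | pole: "partial_fractions (geometric_fps c ^ Suc n)"
  | add: "partial_fractions f \<Longrightarrow> partial_fractions g \<Longrightarrow> partial_fractions (f + g)"
  | scale: "partial_fractions f \<Longrightarrow> partial_fractions (fps_const c * f)"

lemma partial_fractions_linear:
  "partial_fractions f \<Longrightarrow> partial_fractions g \<Longrightarrow>
    partial_fractions (fps_const c * f + fps_const d * g)"
  by (intro partial_fractions.intros)

lemma partial_fractions_poly: "partial_fractions (fps_of_poly p)"
proof -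
  \<comment> \<open>The extra power of t absorbs the shift caused by \<open>pCons\<close> in the
    induction.\<close>
  have "partial_fractions (fps_of_poly p * fps_X ^ k)" for k
  proof (induction p arbitrary: k)
    case 0
    show ?case
      using partial_fractions.scale[OF partial_fractions.monomial, of 0] by simp
  next
    case (pCons a p)
    show ?case
      using partial_fractions.add[OF partial_fractions.scale[OF partial_fractions.monomial, of a k]
          pCons.IH[of "Suc k"]]
      by (simp add: fps_of_poly_pCons algebra_simps)
  qed
  from this[of 0] show ?thesis
    by simp
qed

text \<open>With u = 1/(1 - ct) and v = 1/(1 - dt), everything follows from cu - dv = (c -
  d)uv.\<close>

lemma geometric_fps_mult_geometric_fps:
  assumes "c \<noteq> d"
  shows "geometric_fps c * geometric_fps d =
    fps_const (c / (c - d)) * geometric_fps c + fps_const (- d / (c - d)) * geometric_fps d"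
proof -
  let ?u = "geometric_fps c" and ?v = "geometric_fps d"
  let ?k = "fps_const (1 / (c - d))"
  have k: "?k * (fps_const c - fps_const d) = 1"
    using assms by (simp add: field_simps flip: fps_const_sub)
  have "l * u - m * v = (l - m) * (u * v)"
    if uv: "(1 - l * x) * u = 1" "(1 - m * x) * v = 1" for l m u v x :: "complex fps"
  proof -
    \<comment> \<open>Each term is multiplied by a factor equal to 1; the two multiples of
      \<open>l * m * x\<close> then cancel.\<close>
    have "l * u - m * v = l * u * ((1 - m * x) * v) - m * v * ((1 - l * x) * u)"
      by (simp add: uv)
    also have "\<dots> = (l - m) * (u * v)"
      by (simp add: algebra_simps)
    finally show ?thesis .
  qed
  from this[OF geometric_fps_mult geometric_fps_mult]
  have "fps_const c * ?u - fps_const d * ?v = (fps_const c - fps_const d) * (?u * ?v)" .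
  then have "?k * (fps_const c * ?u - fps_const d * ?v) = ?u * ?v"
    using k by (simp flip: mult.assoc)
  then show ?thesis
    by (simp add: right_diff_distrib flip: mult.assoc fps_const_neg)
qed

lemma fps_X_mult_geometric_fps:
  assumes "c \<noteq> 0"
  shows "fps_X * geometric_fps c = fps_const (1 / c) * geometric_fps c + fps_const (- 1 / c) * 1"
proof -
  have "x * u = k * u + - k * 1"
    if "k * l = 1" "(1 - l * x) * u = 1" for k l u x :: "complex fps"
  proof -
    have "k * u + - k * 1 = k * u + - k * ((1 - l * x) * u)"
      by (simp add: that(2))
    also have "\<dots> = (k * l) * (x * u)"
      by (simp add: algebra_simps)
    finally show ?thesis
      by (simp add: that(1))
  qed
  from this[OF _ geometric_fps_mult, of "fps_const (1 / c)"] show ?thesis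
    using assms by simp
qed

text \<open>By linearity only generators matter. The two preceding identities lower the power of t,
  or the order of the pole at 1/c, until the product splits; for c = d the order just rises by
  one.\<close>

lemma partial_fractions_mult_geometric:
  "partial_fractions f \<Longrightarrow> partial_fractions (f * geometric_fps d)"
proof (induction rule: partial_fractions.induct)
  case (monomial k)
  show ?case
  proof (cases "d = 0")
    \<comment> \<open>\<open>geometric_fps 0\<close> is 1.\<close>
    case True
    then show ?thesis
      using partial_fractions.monomial by (simp add: geometric_fps_def)
  next
    case False
    show ?thesis
    proof (induction k)
      case 0
      show ?case
        using partial_fractions.pole[of d 0] by simp
    next
      case (Suc k)
      have "fps_X ^ Suc k * geometric_fps d = fps_X ^ k * (fps_X * geometric_fps d)"
        by simp
      also have "\<dots> = fps_const (1 / d) * (fps_X ^ k * geometric_fps d) +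
          fps_const (- 1 / d) * fps_X ^ k"
        unfolding fps_X_mult_geometric_fps[OF False] by (simp add: algebra_simps)
      finally show ?case
        using partial_fractions_linear[OF Suc partial_fractions.monomial] by simp
    qed
  qed
next
  case (pole c n)
  show ?case
  proof (cases "c = d")
    case True
    then show ?thesis
      using partial_fractions.pole[of c "Suc n"] by (simp add: mult_ac)
  next
    case False
    show ?thesis
    proof (induction n)
      case 0
      show ?case
        using partial_fractions_linear partial_fractions.pole[of _ 0]
        by (simp add: geometric_fps_mult_geometric_fps[OF False])
    next
      case (Suc n)
      have "geometric_fps c ^ Suc (Suc n) * geometric_fps d =
          geometric_fps c ^ Suc n * (geometric_fps c * geometric_fps d)"
        by (simp add: mult_ac)
      also have "\<dots> = fps_const (c / (c - d)) * geometric_fps c ^ Suc (Suc n) +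
          fps_const (- d / (c - d)) * (geometric_fps c ^ Suc n * geometric_fps d)"
        unfolding geometric_fps_mult_geometric_fps[OF False] by (simp add: algebra_simps)
      finally show ?case
        by (simp only: partial_fractions_linear partial_fractions.pole Suc)
    qed
  qed
next
  case (add f g)
  then show ?case
    by (simp add: distrib_right partial_fractions.add)
next
  case (scale f c)
  then show ?case
    by (simp add: mult.assoc partial_fractions.scale)
qed

text \<open>Induction on the degree of the denominator, splitting off a root z. A root at 0 cancels
  against the numerator since \<open>f\<close> has no pole there; any other root costs one geometric
  factor.\<close>

lemma partial_fractions_quotient:
  assumes "q \<noteq> 0" "f * fps_of_poly q = fps_of_poly p"
  shows "partial_fractions f"
  using assms
proof (induction "Polynomial.degree q" arbitrary: f p q)
  case 0
  then obtain c where c: "q = [:c:]" "c \<noteq> 0"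
    using degree_eq_zeroE by (metis pCons_0_0)
  have "f = fps_const (1 / c) * (f * fps_of_poly q)"
    using c by (simp add: mult.left_commute)
  then show ?case
    using partial_fractions.scale[OF partial_fractions_poly] 0(3) by metis
next
  case (Suc n)
  have "\<not> constant (poly q)"
    using Suc.hyps(2) by (simp add: constant_degree)
  then obtain z where "poly q z = 0"
    using fundamental_theorem_of_algebra by blast
  then obtain r where r: "q = [:- z, 1:] * r"
    by (auto simp: poly_eq_0_iff_dvd)
  with Suc.prems(1) have r0: "r \<noteq> 0"
    by auto
  with r Suc.hyps(2) have deg: "n = Polynomial.degree r"
    by (simp add: degree_mult_eq del: mult_pCons_left)
  have qr: "fps_of_poly q = (fps_X - fps_const z) * fps_of_poly r"
    by (simp add: r fps_of_poly_mult fps_of_poly_pCons algebra_simps del: mult_pCons_left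
      flip: fps_const_neg)
  show ?case
  proof (cases "z = 0")
    case True
    have "coeff p 0 = 0"
      using arg_cong[OF Suc.prems(2), of "\<lambda>g. fps_nth g 0"] by (simp add: qr True)
    then obtain s where s: "p = pCons 0 s"
      by (cases p) auto
    have "fps_X * (f * fps_of_poly r) = fps_X * fps_of_poly s"
      using Suc.prems(2) by (simp add: qr True s fps_of_poly_pCons mult_ac)
    then have "f * fps_of_poly r = fps_of_poly s"
      by simp
    then show ?thesis
      using Suc.hyps(1)[OF deg r0] by blast
  next
    case False
    \<comment> \<open>\<open>?g\<close> has denominator \<open>r\<close>. Since t - z = -z (1 -
      t/z), \<open>f\<close> is recovered from it by the factor -1/z and
      \<open>geometric_fps (1 / z)\<close>.\<close>
    let ?g = "f * (fps_X - fps_const z)"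
    have "?g * fps_of_poly r = fps_of_poly p"
      using Suc.prems(2) by (simp add: qr mult.assoc)
    then have "partial_fractions ?g"
      by (rule Suc.hyps(1)[OF deg r0])
    then have "partial_fractions (fps_const (- 1 / z) * (?g * geometric_fps (1 / z)))"
      by (intro partial_fractions.scale partial_fractions_mult_geometric)
    moreover have lin: "fps_const (- 1 / z) * (fps_X - fps_const z) = 1 - fps_const (1 / z) * fps_X"
      using False by (simp add: right_diff_distrib flip: fps_const_neg)
    have "fps_const (- 1 / z) * (?g * geometric_fps (1 / z)) =
        f * ((fps_const (- 1 / z) * (fps_X - fps_const z)) * geometric_fps (1 / z))"
      by (simp only: mult_ac)
    then have "fps_const (- 1 / z) * (?g * geometric_fps (1 / z)) = f"
      unfolding lin geometric_fps_mult by simp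
    ultimately show ?thesis
      by (simp only:)
  qed
qed

lemma rational_imp_partial_fractions:
  assumes "rational_fps f"
  shows "partial_fractions f"
proof -
  obtain p q where q: "q \<noteq> 0"
    "fps_to_fls f = fps_to_fls (fps_of_poly p) / fps_to_fls (fps_of_poly q)"
    using assms by (auto simp: rational_fps_def rational_functions_def)
  then have "fps_to_fls (f * fps_of_poly q) = fps_to_fls (fps_of_poly p)"
    by (simp add: fls_times_fps_to_fls)
  then show ?thesis
    using partial_fractions_quotient q(1) by simp
qed

subsection \<open>Multipliers\<close>

definition lr_multiplier :: "complex fps \<Rightarrow> bool"
  where "lr_multiplier a \<longleftrightarrow> (\<forall>b. algebraic_fps b \<longrightarrow> algebraic_fps (a \<star>\<^sub>L\<^sub>R b))"

lemma lr_multiplier_add: "lr_multiplier a \<Longrightarrow> lr_multiplier a' \<Longrightarrow> lr_multiplier (a + a')"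
  by (simp add: lr_multiplier_def lr_derived_add_left algebraic_fps_add)

lemma lr_multiplier_scale: "lr_multiplier a \<Longrightarrow> lr_multiplier (fps_const c * a)"
  by (simp add: lr_multiplier_def lr_derived_const_left algebraic_fps_mult
      rational_imp_algebraic_fps rational_fps_const)

lemma lr_multiplier_lr_derived:
  "lr_multiplier a \<Longrightarrow> lr_multiplier a' \<Longrightarrow> lr_multiplier (a \<star>\<^sub>L\<^sub>R a')"
  by (simp add: lr_multiplier_def lr_derived_assoc)

text \<open>The derivation rule is solved for \<open>fps_XD a \<star>\<^sub>L\<^sub>R b\<close>; its
  other terms are algebraic because \<open>fps_XD b\<close> is.\<close>

lemma lr_multiplier_XD:
  assumes "lr_multiplier a"
  shows "lr_multiplier (fps_XD a)"
  unfolding lr_multiplier_def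
proof (intro allI impI)
  fix b assume b: "algebraic_fps b"
  have "fps_XD a \<star>\<^sub>L\<^sub>R b = fps_XD (a \<star>\<^sub>L\<^sub>R b) + - (a \<star>\<^sub>L\<^sub>R fps_XD b)"
    by (simp add: fps_XD_lr_derived)
  moreover have "algebraic_fps (fps_XD (a \<star>\<^sub>L\<^sub>R b))" "algebraic_fps (a \<star>\<^sub>L\<^sub>R fps_XD b)"
    using assms b by (simp_all add: lr_multiplier_def algebraic_fps_XD)
  ultimately show "algebraic_fps (fps_XD a \<star>\<^sub>L\<^sub>R b)"
    by (simp only: algebraic_fps_add algebraic_fps_minus)
qed

lemma lr_multiplier_X_power: "lr_multiplier (fps_X ^ k)"
proof (induction k)
  case 0
  show ?case
    by (simp add: lr_multiplier_def lr_derived_1_left)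
next
  case (Suc k)
  have "lr_multiplier fps_X"
    by (simp add: lr_multiplier_def lr_derived_X_left algebraic_fps_XD algebraic_fps_mult
        rational_imp_algebraic_fps rational_fps_X)
  \<comment> \<open>\<open>fps_X \<star>\<^sub>L\<^sub>R fps_X ^ k\<close> is \<theta> of t^(k+1),
    that is, k + 1 times this power.\<close>
  then have "lr_multiplier (fps_const (1 / of_nat (Suc k)) * (fps_X \<star>\<^sub>L\<^sub>R fps_X ^ k))"
    using Suc by (intro lr_multiplier_scale lr_multiplier_lr_derived)
  moreover have "fps_const (1 / of_nat (Suc k)) * (fps_X \<star>\<^sub>L\<^sub>R fps_X ^ k) = fps_X ^ Suc k"
    unfolding lr_derived_X_left power_Suc[symmetric]
    by (auto simp: fps_eq_iff simp del: power_Suc of_nat_Suc)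
  ultimately show ?case
    by simp
qed

lemma lr_multiplier_geometric_power: "lr_multiplier (geometric_fps c ^ Suc n)"
proof (induction n)
  case 0
  have "geometric_fps c \<noteq> 0"
    using geometric_fps_mult[of c] by auto
  then have "algebraic_fps (b oo (fps_X * geometric_fps c))" if "algebraic_fps b" for b
    using that by (intro algebraic_fps_compose)
      (simp_all add: rational_fps_mult rational_fps_X rational_geometric_fps)
  then show ?case
    by (simp add: lr_multiplier_def geometric_lr_derived algebraic_fps_mult
        rational_imp_algebraic_fps rational_geometric_fps)
next
  case (Suc n)
  have "fps_const (1 / of_nat (Suc n)) * fps_const (of_nat (Suc n)) = (1 :: complex fps)"
    by (simp del: of_nat_Suc)
  \<comment> \<open>The formula for \<theta> on a power of 1/(1 - ct), solved for the next higher
    power.\<close>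
  then have "geometric_fps c ^ Suc (Suc n) =
      fps_const (1 / of_nat (Suc n)) * fps_XD (geometric_fps c ^ Suc n) + geometric_fps c ^ Suc n"
    unfolding fps_XD_geometric_power mult.assoc[symmetric] by simp
  then show ?case
    using Suc by (simp only: lr_multiplier_add lr_multiplier_scale lr_multiplier_XD)
qed

lemma partial_fractions_imp_lr_multiplier: "partial_fractions a \<Longrightarrow> lr_multiplier a"
  by (induction rule: partial_fractions.induct)
    (simp_all only: lr_multiplier_X_power lr_multiplier_geometric_power lr_multiplier_add
      lr_multiplier_scale)

theorem theorem7:
  fixes a b :: "complex fps"
  assumes "rational_fps a" and "algebraic_fps b"
  shows "algebraic_fps (a \<star>\<^sub>L\<^sub>R b)"
  using assms partial_fractions_imp_lr_multiplier[OF rational_imp_partial_fractions]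
  by (simp add: lr_multiplier_def)

end
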